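(* Let $G\not\cong K_2$ be a connected bipartite graph with bipartition classes $P_1$ and $P_2$. Let $u\in P_1$ and $v\in P_2$ be adjacent. Write $d_u=d(\langle\{u\}\rangle,Res(G,\langle\{u\}\rangle))$ and $d_v=d(\langle\{v\}\rangle,Res(G,\langle\{v\}\rangle))$. Then exactly one of $d_u=d_v$, $d_u=d_v+1$, $d_v=d_u+1$ holds, and \[Res(G,\langle\{u,v\}\rangle)=\begin{cases}\left\langle V(Res(G,\langle\{u\}\rangle))\cup V(Res(G,\langle\{v\}\rangle))\right\rangle, & \text{if } d_u=d_v;\\ Res(G,\langle\{u\}\rangle), & \text{if } d_u=d_v+1;\\ Res(G,\langle\{v\}\rangle), & \text{if } d_v=d_u+1.\end{cases}\]
   Context: For a connected finite graph $G$ and a nonempty set $V_0\subseteq V(G)$, let $V_i$ be the set of vertices at distance exactly $i$ from $V_0$, and let $r$ be the largest $i$ with $V_i\neq\emptyset$. The root is $R=\langle V_0\rangle$ and the distance-residual graph is $Res(G,R)=\langle V_r\rangle$ (induced subgraphs). For subgraphs $R,H$ of $G$, $d(R,H)=\min_{x\in V(R),y\in V(H)} d(x,y)$; thus $d(R,Res(G,R))=r$. $\langle S\rangle$ denotes the subgraph induced on $S$. *)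

theory Defs
  imports "Graph_Theory.Graph_Theory"
begin

text \<open>
  A finite simple graph is a symmetric, loop-free digraph without parallel arcs (locale
  \<^locale>\<open>graph\<close>); every edge is a pair of opposite arcs, so arc walks are ordinary walks and their
  length is the number of edges. The induced subgraph on \<open>S\<close> is \<open>G \<restriction> S\<close>.
\<close>

definition bipartition :: "('a,'b) pre_digraph \<Rightarrow> 'a set \<Rightarrow> 'a set \<Rightarrow> bool" where
  "bipartition G P1 P2 \<longleftrightarrow>
     verts G = P1 \<union> P2 \<and> P1 \<inter> P2 = {} \<and> arcs_ends G \<subseteq> P1 \<times> P2 \<union> P2 \<times> P1"

text \<open>Meaningful only if \<open>y\<close> is reachable from \<open>x\<close>, hence for all vertices of a connected graph.\<close>
definition vdist :: "('a,'b) pre_digraph \<Rightarrow> 'a \<Rightarrow> 'a \<Rightarrow> nat" where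
  "vdist G x y = (LEAST n. \<exists>p. pre_digraph.awalk G x p y \<and> length p = n)"

text \<open>The library's weighted distance with unit weights is the same notion.\<close>
lemma (in wf_digraph) vdist_eq_unit_weight_distance:
  assumes "x \<rightarrow>\<^sup>* y"
  shows "\<mu> (\<lambda>_. 1) x y = ereal (real (vdist G x y))"
proof -
  have cost: "awalk_cost (\<lambda>_. 1) p = real (length p)" for p :: "'b list"
    by (induct p) auto
  have "\<exists>n p. awalk x p y \<and> length p = n"
    using assms by (auto simp: reachable_awalk)
  then have "\<exists>p. awalk x p y \<and> length p = vdist G x y"
    unfolding vdist_def by (rule LeastI_ex)
  moreover have "vdist G x y \<le> length p" if "awalk x p y" for p
    unfolding vdist_def using that by (intro Least_le) blast
  ultimately show ?thesis
    unfolding \<mu>_def cost by (intro antisym INF_greatest) (auto intro: INF_lower2)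
qed

text \<open>The minimum is over a finite nonempty set whenever \<open>A\<close> and \<open>B\<close> are finite and nonempty.\<close>
definition set_dist :: "('a,'b) pre_digraph \<Rightarrow> 'a set \<Rightarrow> 'a set \<Rightarrow> nat" where
  "set_dist G A B = Min ((\<lambda>(x, y). vdist G x y) ` (A \<times> B))"

definition subgraph_dist ::
    "('a,'b) pre_digraph \<Rightarrow> ('a,'b) pre_digraph \<Rightarrow> ('a,'b) pre_digraph \<Rightarrow> nat" where
  "subgraph_dist G R H = set_dist G (verts R) (verts H)"

definition dist_level :: "('a,'b) pre_digraph \<Rightarrow> 'a set \<Rightarrow> nat \<Rightarrow> 'a set" where
  "dist_level G V0 i = {x \<in> verts G. set_dist G V0 {x} = i}"

definition last_level :: "('a,'b) pre_digraph \<Rightarrow> 'a set \<Rightarrow> nat" where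
  "last_level G V0 = Max {i. dist_level G V0 i \<noteq> {}}"

definition Res :: "('a,'b) pre_digraph \<Rightarrow> ('a,'b) pre_digraph \<Rightarrow> ('a,'b) pre_digraph" where
  "Res G R = G \<restriction> dist_level G (verts R) (last_level G (verts R))"

end

theory Submission
  imports Defs
begin

text \<open>
  Write \<open>f\<close> and \<open>g\<close> for the distances from \<open>u\<close> and from \<open>v\<close>, so that \<open>min f g\<close> is the distance
  from \<open>{u, v}\<close>. By the triangle inequality \<open>f\<close> and \<open>g\<close> differ by at most one at every vertex, and
  by bipartiteness they have different parity there, so they differ by exactly one. Comparing the
  maxima of \<open>f\<close>, \<open>g\<close> and \<open>min f g\<close> then gives the three cases.
\<close>

lemma set_dist_singletons: "set_dist G {u} {x} = vdist G u x"
  by (simp add: set_dist_def)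

lemma set_dist_doubleton: "set_dist G {u, v} {x} = min (vdist G u x) (vdist G v x)"
proof -
  have "{u, v} \<times> {x} = {(u, x), (v, x)}" by auto
  then show ?thesis by (simp add: set_dist_def)
qed

text \<open>A level is nonempty exactly when its index is a value of the distance function on
  \<open>verts G\<close>. Bounds on \<open>last_level\<close> thereby become statements about a
  maximum over a finite image.\<close>

lemma last_level_eq_Max: "last_level G S = Max ((\<lambda>x. set_dist G S {x}) ` verts G)"
  unfolding last_level_def dist_level_def by (rule arg_cong[where f = Max]) auto

lemma last_level_eqI:
  assumes "finite (verts G)" "\<And>x. x \<in> verts G \<Longrightarrow> set_dist G S {x} \<le> n"
    and "y \<in> verts G" "set_dist G S {y} = n"
  shows "last_level G S = n"
  unfolding last_level_eq_Max using assms by (intro Max_eqI) auto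

lemma set_dist_le_last_level:
  assumes "finite (verts G)" "x \<in> verts G"
  shows "set_dist G S {x} \<le> last_level G S"
  unfolding last_level_eq_Max using assms by (intro Max_ge) auto

lemma last_level_attained:
  assumes "finite (verts G)" "verts G \<noteq> {}"
  obtains y where "y \<in> verts G" "set_dist G S {y} = last_level G S"
proof -
  have "last_level G S \<in> (\<lambda>x. set_dist G S {x}) ` verts G"
    unfolding last_level_eq_Max using assms by (intro Max_in) auto
  then show ?thesis using that by auto
qed

text \<open>All vertices of the residual graph lie at the same distance from \<open>u\<close>, and
  there is at least one, so the minimum runs over a one-element set.\<close>

lemma subgraph_dist_Res_singleton:
  assumes "finite (verts G)" "verts G \<noteq> {}"
  shows "subgraph_dist G (G \<restriction> {u}) (Res G (G \<restriction> {u})) = last_level G {u}"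
proof -
  let ?L = "dist_level G {u} (last_level G {u})"
  obtain y where y: "y \<in> verts G" "set_dist G {u} {y} = last_level G {u}"
    using last_level_attained assms by blast
  then have "y \<in> ?L" by (simp add: dist_level_def)
  then have "(\<lambda>(x, y). vdist G x y) ` ({u} \<times> ?L) = {last_level G {u}}"
    by (force simp: dist_level_def set_dist_singletons)
  then show ?thesis
    by (simp add: subgraph_dist_def Res_def set_dist_def)
qed

context wf_digraph
begin

lemma vdist_le_length: "awalk x p y \<Longrightarrow> vdist G x y \<le> length p"
  unfolding vdist_def by (rule Least_le) blast

lemma shortest_awalk:
  assumes "x \<rightarrow>\<^sup>* y"
  obtains p where "awalk x p y" "length p = vdist G x y"
proof -
  have "\<exists>n p. awalk x p y \<and> length p = n"
    using assms by (auto simp: reachable_awalk)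
  then have "\<exists>p. awalk x p y \<and> length p = vdist G x y"
    unfolding vdist_def by (rule LeastI_ex)
  then show ?thesis using that by blast
qed

text \<open>Prepend the arc from \<open>u\<close> to \<open>v\<close> to a shortest walk from
  \<open>v\<close>; reachability ensures that such a walk exists.\<close>

lemma vdist_le_Suc_vdist:
  assumes "u \<rightarrow> v" "v \<rightarrow>\<^sup>* x"
  shows "vdist G u x \<le> Suc (vdist G v x)"
proof -
  obtain p where p: "awalk v p x" "length p = vdist G v x"
    using shortest_awalk assms(2) .
  obtain e where "e \<in> arcs G" "tail G e = u" "head G e = v"
    using assms(1) by (auto simp: arcs_ends_def arc_to_ends_def)
  then have "awalk u (e # p) x" using p by (auto simp: awalk_Cons_iff)
  then show ?thesis using vdist_le_length[of u "e # p" x] p by simp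
qed

text \<open>Each arc of the walk switches the bipartition class.\<close>

lemma bipartition_awalk_parity:
  assumes "bipartition G P1 P2" "awalk x p y"
  shows "even (length p) \<longleftrightarrow> (x \<in> P1 \<longleftrightarrow> y \<in> P1)"
  using assms(2)
proof (induction p arbitrary: x)
  case Nil
  then show ?case by (simp add: awalk_Nil_iff)
next
  case (Cons e p)
  then have e: "e \<in> arcs G" "x = tail G e" and "awalk (head G e) p y"
    by (auto simp: awalk_Cons_iff)
  moreover have "(tail G e, head G e) \<in> P1 \<times> P2 \<union> P2 \<times> P1"
    using assms(1) e by (auto simp: bipartition_def arcs_ends_def arc_to_ends_def)
  moreover have "P1 \<inter> P2 = {}" using assms(1) by (simp add: bipartition_def)
  ultimately show ?case using Cons.IH[of "head G e"] by auto
qed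

lemma bipartition_vdist_parity:
  assumes "bipartition G P1 P2" "x \<rightarrow>\<^sup>* y"
  shows "even (vdist G x y) \<longleftrightarrow> (x \<in> P1 \<longleftrightarrow> y \<in> P1)"
  using shortest_awalk[OF assms(2)] bipartition_awalk_parity[OF assms(1)] by metis

end

lemma adjacent_vdist_differ_by_one:
  assumes "graph G" "connected G" "bipartition G P1 P2" "u \<in> P1" "v \<in> P2" "u \<rightarrow>\<^bsub>G\<^esub> v"
    and "x \<in> verts G"
  shows "vdist G u x = Suc (vdist G v x) \<or> vdist G v x = Suc (vdist G u x)"
proof -
  interpret graph G by fact
  have vu: "v \<rightarrow>\<^bsub>G\<^esub> u" using sym_arcs assms(6) by (rule arcs_ends_symmetric)
  have uv: "u \<in> verts G" "v \<in> verts G" "u \<in> P1" "v \<notin> P1"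
    using assms(3-5) by (auto simp: bipartition_def)
  \<comment> \<open>\<open>connected\<close> means strong connectivity of
    \<open>mk_symmetric G\<close>; since the arcs of \<open>G\<close> are already symmetric,
    reachability there is reachability in \<open>G\<close>.\<close>
  have r: "u \<rightarrow>\<^sup>*\<^bsub>G\<^esub> x" "v \<rightarrow>\<^sup>*\<^bsub>G\<^esub> x"
    using assms(2,7) uv
    by (auto simp: connected_def strongly_connected_def reachable_mk_symmetric_eq[OF sym_arcs])
  have "even (vdist G u x) \<noteq> even (vdist G v x)"
    using bipartition_vdist_parity[OF assms(3)] r uv by simp
  moreover have "vdist G u x \<noteq> vdist G v x" using calculation by auto
  ultimately show ?thesis
    using vdist_le_Suc_vdist[OF assms(6) r(2)] vdist_le_Suc_vdist[OF vu r(1)] by linarith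
qed

theorem theorem2:
  fixes G :: "('a,'b) pre_digraph" and P1 P2 :: "'a set" and u v :: 'a
  assumes "graph G"
    and "connected G"
    and "bipartition G P1 P2"
    and "\<not> complete_digraph 2 G"
    and "u \<in> P1" and "v \<in> P2"
    and "u \<rightarrow>\<^bsub>G\<^esub> v"
  shows "let du = subgraph_dist G (G \<restriction> {u}) (Res G (G \<restriction> {u}));
             dv = subgraph_dist G (G \<restriction> {v}) (Res G (G \<restriction> {v}))
         in (du = dv \<or> du = dv + 1 \<or> dv = du + 1) \<and>
            \<not> (du = dv \<and> du = dv + 1) \<and>
            \<not> (du = dv \<and> dv = du + 1) \<and>
            \<not> (du = dv + 1 \<and> dv = du + 1) \<and>
            (du = dv \<longrightarrow> Res G (G \<restriction> {u, v}) =
               G \<restriction> (verts (Res G (G \<restriction> {u})) \<union> verts (Res G (G \<restriction> {v})))) \<and>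
            (du = dv + 1 \<longrightarrow> Res G (G \<restriction> {u, v}) = Res G (G \<restriction> {u})) \<and>
            (dv = du + 1 \<longrightarrow> Res G (G \<restriction> {u, v}) = Res G (G \<restriction> {v}))"
proof -
  interpret graph G by fact
  have fin: "finite (verts G)" by simp
  have ne: "verts G \<noteq> {}"
    using assms(3,5) by (auto simp: bipartition_def)
  define f g where "f = vdist G u" and "g = vdist G v"
  define a b where "a = last_level G {u}" and "b = last_level G {v}"
  have sd: "set_dist G {u} {x} = f x" "set_dist G {v} {x} = g x"
    "set_dist G {u, v} {x} = min (f x) (g x)" for x
    by (simp_all add: f_def g_def set_dist_singletons set_dist_doubleton)
  have diff: "f x = Suc (g x) \<or> g x = Suc (f x)" if "x \<in> verts G" for x
    unfolding f_def g_def using adjacent_vdist_differ_by_one assms that by metis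
  have le: "f x \<le> a" "g x \<le> b" if "x \<in> verts G" for x
    using set_dist_le_last_level[OF fin that] by (simp_all add: a_def b_def flip: sd)
  obtain y where y: "y \<in> verts G" "f y = a"
    using last_level_attained[OF fin ne, of "{u}"] by (auto simp: a_def sd)
  obtain z where z: "z \<in> verts G" "g z = b"
    using last_level_attained[OF fin ne, of "{v}"] by (auto simp: b_def sd)
  \<comment> \<open>At \<open>y\<close>, where \<open>f\<close> is maximal, \<open>g\<close> is at
    least \<open>a - 1\<close> and at most \<open>b\<close>, so a \<le> b + 1; \<open>z\<close>
    gives the other bound.\<close>
  have ab: "a = b \<or> a = b + 1 \<or> b = a + 1"
    using diff[OF y(1)] diff[OF z(1)] le[OF y(1)] le[OF z(1)] y(2) z(2) by linarith
  have eq: "dist_level G {u, v} (last_level G {u, v}) = dist_level G {u} a \<union> dist_level G {v} b"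
    if "a = b"
  proof -
    \<comment> \<open>Both values are at most \<open>a\<close> and differ by one, so the smaller is
      at most \<open>a - 1\<close>. This also forces a \<ge> 1, so the subtraction is not
      truncated.\<close>
    have m: "min (f x) (g x) \<le> a - 1" if "x \<in> verts G" for x
      using diff[OF that] le[OF that] \<open>a = b\<close> by auto
    have "min (f y) (g y) = a - 1"
      using diff[OF y(1)] le[OF y(1)] y(2) that by auto
    then have "last_level G {u, v} = a - 1"
      using m y(1) by (intro last_level_eqI[OF fin]) (simp_all add: sd)
    \<comment> \<open>The larger value is the minimum plus one, so the minimum is
      \<open>a - 1\<close> exactly when one of the two distances reaches the common maximum.\<close>
    moreover have "min (f x) (g x) = a - 1 \<longleftrightarrow> f x = a \<or> g x = b" if "x \<in> verts G" for x
      using diff[OF that] le[OF that] \<open>a = b\<close> diff[OF y(1)] le[OF y(1)] y(2) by auto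
    ultimately show ?thesis by (auto simp: dist_level_def sd)
  qed
  have u_far: "dist_level G {u, v} (last_level G {u, v}) = dist_level G {u} a" if "a = b + 1"
  proof -
    have m: "min (f x) (g x) \<le> b" if "x \<in> verts G" for x
      using le[OF that] by auto
    have "min (f y) (g y) = b"
      using diff[OF y(1)] le[OF y(1)] y(2) that by auto
    then have "last_level G {u, v} = b"
      using m y(1) by (intro last_level_eqI[OF fin]) (simp_all add: sd)
    \<comment> \<open>If \<open>f x\<close> is b + 1, then \<open>g x\<close> is \<open>b\<close>,
      as b + 2 exceeds its maximum. Conversely, a minimum of \<open>b\<close> forces
      \<open>g x\<close> to be \<open>b\<close>, and then \<open>f x\<close> can only be b +
      1.\<close>
    moreover have "min (f x) (g x) = b \<longleftrightarrow> f x = a" if "x \<in> verts G" for x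
      using diff[OF that] le[OF that] \<open>a = b + 1\<close> by auto
    ultimately show ?thesis by (auto simp: dist_level_def sd)
  qed
  \<comment> \<open>The mirror image of \<open>u_far\<close>, with \<open>z\<close> in place of
    \<open>y\<close>.\<close>
  have v_far: "dist_level G {u, v} (last_level G {u, v}) = dist_level G {v} b" if "b = a + 1"
  proof -
    have m: "min (f x) (g x) \<le> a" if "x \<in> verts G" for x
      using le[OF that] by auto
    have "min (f z) (g z) = a"
      using diff[OF z(1)] le[OF z(1)] z(2) that by auto
    then have "last_level G {u, v} = a"
      using m z(1) by (intro last_level_eqI[OF fin]) (simp_all add: sd)
    moreover have "min (f x) (g x) = a \<longleftrightarrow> g x = b" if "x \<in> verts G" for x
      using diff[OF that] le[OF that] \<open>b = a + 1\<close> by auto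
    ultimately show ?thesis by (auto simp: dist_level_def sd)
  qed
  \<comment> \<open>All residual graphs are restrictions of \<open>G\<close>, so equal vertex sets
    suffice.\<close>
  show ?thesis
    unfolding Let_def subgraph_dist_Res_singleton[OF fin ne] a_def[symmetric] b_def[symmetric]
    using ab eq u_far v_far
    by (auto simp: Res_def simp flip: a_def b_def)
qed

end
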